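(* Consider the system $\dot x=f(x)+\phi(x)^T\theta+g(x)u$ with unknown constant parameter $\theta\in\mathbb{R}^p$ and a zeroing control barrier function $h$ with associated extended class $\mathcal{K}$ function $\alpha_4$. Assume that (1) $h(x(0))>\epsilon$ for a positive constant $\epsilon$; (2) there exist positive constants $\overline\chi$ and $\sigma$ such that $\dfrac{y}{\alpha_4(y)}\ge\sigma$ for all $y\in(0,\overline\chi]$. Apply the adaptive control scheme consisting of the QP-based controller, the batch least-squares parameter update law and the safety-triggered update moments $\tau_i$ defined in the context (with this $\overline\chi$ used in the triggering condition). Then the parameter update law does not exhibit Zeno behavior: along solutions of the closed-loop system, it is not the case that infinitely many triggering moments $\tau_i$ occur within a finite time interval.
   Context: System: $\mathcal{X}\subset\mathbb{R}^n$ is a path-connected state space with $0\in\mathcal{X}$; $f:\mathcal{X}\to\mathbb{R}^n$, $\phi:\mathcal{X}\to\mathbb{R}^{p\times n}$, $g:\mathcal{X}\to\mathbb{R}^{n\times m}$ are known locally Lipschitz functions; $x\in\mathcal{X}$ is the state, $u\in\mathbb{R}^m$ the control input, $\theta\in\mathbb{R}^p$ an unknown constant vector. Function classes: a continuous $\alpha:[0,a)\to[0,\infty)$ is class $\mathcal{K}$ if it is strictly increasing with $\alpha(0)=0$; it is class $\mathcal{K}_\infty$ if also $a=\infty$ and $\alpha(r)\to\infty$ as $r\to\infty$. A continuous $\beta:(-b,a)\to(-\infty,\infty)$ is extended class $\mathcal{K}$ (for some $a,b>0$) if it is strictly increasing with $\beta(0)=0$. Control Lyapunov function: $V:\mathcal{X}\to[0,\infty)$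 is continuously differentiable and there are class $\mathcal{K}_\infty$ functions $\alpha_1,\alpha_2$ and a class $\mathcal{K}$ function $\alpha_3$ with, for all $x\in\mathcal{X}$, $\alpha_1(\|x\|)\le V(x)\le\alpha_2(\|x\|)$ and $\inf_{u\in\mathbb{R}^m}\big[\frac{\partial V(x)}{\partial x}(f(x)+\phi(x)^T\theta+g(x)u)\big]\le-\alpha_3(\|x\|)$. Control barrier function: $h:\mathcal{X}\to\mathbb{R}$ is continuously differentiable, the safe set is $\mathcal{C}=\{x\in\mathcal{X}:h(x)\ge0\}$, with $\partial\mathcal{C}=\{x\in\mathcal{X}:h(x)=0\}$ and $\operatorname{Int}(\mathcal{C})=\{x\in\mathcal{X}:h(x)>0\}$. $h$ is a zeroing control barrier function: there is an extended class $\mathcal{K}$ function $\alpha_4$ with $\sup_{u\in\mathbb{R}^m}\big[\frac{\partial h(x)}{\partial x}(f(x)+\phi(x)^T\theta+g(x)u)\big]\ge-\alpha_4(h(x))$ for all $x\in\mathcal{C}$. Controller: $u$ is the $u$-component of the minimizer $v=[u,\delta]\in\mathbb{R}^{m+1}$ ($\delta\in\mathbb{R}$ a relaxation variable) of $\frac12v^TH(x)v+F(x)^Tv$ subject to $$\frac{\partial V(x)}{\partial x}\big(f(x)+\phi(x)^T\hat\theta(t)+g(x)u\big)+\alpha_3(\|x\|)\le\delta,\qquad \frac{\partial h(x)}{\partial x}\big(f(x)+\phi(x)^T\hat\theta(t)+g(x)u\big)+\alpha_4(h(x))\ge0,$$ where $H(x)\in\mathbb{R}^{(m+1)\times(m+1)}$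 is positive definite and $F(x)\in\mathbb{R}^{m+1}$. Data: for $t,s\ge0$, $p(t,s)=x(t)-x(s)-\int_s^t(f(x(r))+g(x(r))u(r))\,dr$, $q(t,s)=\int_s^t\phi(x(r))^T\,dr$, and $G(\tau)=\int_0^\tau\int_0^\tau q(t,s)^Tq(t,s)\,ds\,dt$, $Z(\tau)=\int_0^\tau\int_0^\tau q(t,s)^Tp(t,s)\,ds\,dt$. Parameter update law: given an initial estimate $\hat\theta(0)\in\mathbb{R}^p$ and $\tau_0=0$, for $i\ge1$, $$\hat\theta(\tau_i)=\operatorname*{argmin}_{\vartheta\in\mathbb{R}^p}\big\{\|\vartheta-\hat\theta(\tau_{i-1})\|^2\big\}\quad\text{subject to}\quad Z(\tau_i)=G(\tau_i)\vartheta,$$ and $\hat\theta(t)=\hat\theta(\tau_i)$ for $t\in[\tau_i,\tau_{i+1})$. Triggering moments: with design constants $0<\gamma_0<1$, $0<\gamma_1<1$, $\Delta\tau_{\max}>0$ and the constant $\overline\chi>0$ of assumption (2), set $\chi_1=\min\{\overline\chi,\gamma_0h(x(0))\}$, $\chi_i=\gamma_1\chi_{i-1}$ for $i\ge2$, and $$\tau_i=\min\Big\{\{t>\tau_{i-1}:h(x(t))=\chi_i\},\ \tau_{i-1}+\Delta\tau_{\max}\Big\},$$ i.e. the first time after $\tau_{i-1}$ at which $h(x(t))=\chi_i$, or $\tau_{i-1}+\Delta\tau_{\max}$, whichever comes first. Zeno: the parameter update law is Zeno if an infinite number of updates (activations at the moments $\tau_i$) occur within a finite time interval. A solution of the closed-loop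 system is a trajectory $x$ of the system with $u$ given by the controller and $\hat\theta$ by the update law. *)

theory Defs
  imports "HOL-Analysis.Analysis"
begin

(* An (m x n)-matrix is an element of real^'n^'m, a family of rows. Functions on the state space
   X are total HOL functions; only their values on X are constrained. Likewise comparison
   functions are total, with their domain of definition given by extended real end points. *)

definition class_K :: "ereal \<Rightarrow> (real \<Rightarrow> real) \<Rightarrow> bool" where
  "class_K a \<alpha> \<longleftrightarrow> 0 < a \<and> continuous_on {r. 0 \<le> r \<and> ereal r < a} \<alpha>
     \<and> strict_mono_on {r. 0 \<le> r \<and> ereal r < a} \<alpha> \<and> \<alpha> 0 = 0"

definition class_K_inf :: "(real \<Rightarrow> real) \<Rightarrow> bool" where
  "class_K_inf \<alpha> \<longleftrightarrow> class_K \<infinity> \<alpha> \<and> filterlim \<alpha> at_top at_top"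

definition ext_class_K :: "ereal \<Rightarrow> ereal \<Rightarrow> (real \<Rightarrow> real) \<Rightarrow> bool" where
  "ext_class_K b a \<beta> \<longleftrightarrow> 0 < a \<and> 0 < b \<and> continuous_on {r. - b < ereal r \<and> ereal r < a} \<beta>
     \<and> strict_mono_on {r. - b < ereal r \<and> ereal r < a} \<beta> \<and> \<beta> 0 = 0"

(* local_lipschitz is the library's notion for functions with an additional time parameter. *)
definition locally_lipschitz_on :: "'a::metric_space set \<Rightarrow> ('a \<Rightarrow> 'b::metric_space) \<Rightarrow> bool" where
  "locally_lipschitz_on X f \<longleftrightarrow> local_lipschitz (UNIV :: real set) X (\<lambda>_. f)"

(* The state space X need not be open, so derivatives are taken within X and the gradient field
   DV (the row vector of partial derivatives of V) is carried along explicitly; on an open X it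
   is determined by V. *)
definition C1_on :: "'a::real_inner set \<Rightarrow> ('a \<Rightarrow> real) \<Rightarrow> ('a \<Rightarrow> 'a) \<Rightarrow> bool" where
  "C1_on X V DV \<longleftrightarrow>
     (\<forall>x\<in>X. (V has_derivative (\<lambda>v. DV x \<bullet> v)) (at x within X)) \<and> continuous_on X DV"

definition sys_rhs ::
  "(real^'n \<Rightarrow> real^'n) \<Rightarrow> (real^'n \<Rightarrow> real^'n^'p) \<Rightarrow> (real^'n \<Rightarrow> real^'m^'n) \<Rightarrow>
   real^'p \<Rightarrow> real^'n \<Rightarrow> real^'m \<Rightarrow> real^'n" where
  "sys_rhs f \<phi> g \<theta> x u = f x + transpose (\<phi> x) *v \<theta> + g x *v u"

(* The infimum and the supremum over u may be infinite and are therefore taken in ereal. *)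
definition is_CLF ::
  "(real^'n) set \<Rightarrow> (real^'n \<Rightarrow> real^'n) \<Rightarrow> (real^'n \<Rightarrow> real^'n^'p) \<Rightarrow> (real^'n \<Rightarrow> real^'m^'n) \<Rightarrow>
   real^'p \<Rightarrow> (real^'n \<Rightarrow> real) \<Rightarrow> (real^'n \<Rightarrow> real^'n) \<Rightarrow> ereal \<Rightarrow> (real \<Rightarrow> real) \<Rightarrow> bool" where
  "is_CLF X f \<phi> g \<theta> V DV a3 \<alpha>3 \<longleftrightarrow>
     (\<forall>x\<in>X. 0 \<le> V x) \<and> C1_on X V DV \<and>
     (\<exists>\<alpha>1 \<alpha>2. class_K_inf \<alpha>1 \<and> class_K_inf \<alpha>2 \<and>
        (\<forall>x\<in>X. \<alpha>1 (norm x) \<le> V x \<and> V x \<le> \<alpha>2 (norm x))) \<and>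
     class_K a3 \<alpha>3 \<and>
     (\<forall>x\<in>X. ereal (norm x) < a3 \<and>
        (INF u. ereal (DV x \<bullet> sys_rhs f \<phi> g \<theta> x u)) \<le> ereal (- \<alpha>3 (norm x)))"

definition safe_set :: "'a set \<Rightarrow> ('a \<Rightarrow> real) \<Rightarrow> 'a set" where
  "safe_set X h = {x\<in>X. 0 \<le> h x}"

definition is_ZCBF ::
  "(real^'n) set \<Rightarrow> (real^'n \<Rightarrow> real^'n) \<Rightarrow> (real^'n \<Rightarrow> real^'n^'p) \<Rightarrow> (real^'n \<Rightarrow> real^'m^'n) \<Rightarrow>
   real^'p \<Rightarrow> (real^'n \<Rightarrow> real) \<Rightarrow> (real^'n \<Rightarrow> real^'n) \<Rightarrow> ereal \<Rightarrow> ereal \<Rightarrow> (real \<Rightarrow> real) \<Rightarrow> bool" where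
  "is_ZCBF X f \<phi> g \<theta> h Dh b4 a4 \<alpha>4 \<longleftrightarrow>
     C1_on X h Dh \<and> ext_class_K b4 a4 \<alpha>4 \<and>
     (\<forall>x\<in>safe_set X h. ereal (h x) < a4 \<and>
        (SUP u. ereal (Dh x \<bullet> sys_rhs f \<phi> g \<theta> x u)) \<ge> ereal (- \<alpha>4 (h x)))"

definition pos_def :: "real^'k^'k \<Rightarrow> bool" where
  "pos_def A \<longleftrightarrow> (\<forall>v. v \<noteq> 0 \<longrightarrow> 0 < v \<bullet> (A *v v))"

(* The m+1 coordinates of v = [u, delta] are indexed by 'm option:
   Some i is the i-th coordinate of u, None is delta. *)
definition u_part :: "real^('m option) \<Rightarrow> real^'m" where
  "u_part v = (\<chi> i. v $ Some i)"

definition slack :: "real^('m::finite option) \<Rightarrow> real" where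
  "slack v = v $ None"

definition qp_cost ::
  "real^('m option)^('m option) \<Rightarrow> real^('m option) \<Rightarrow> real^('m::finite option) \<Rightarrow> real" where
  "qp_cost A c v = 1 / 2 * (v \<bullet> (A *v v)) + c \<bullet> v"

definition qp_feasible ::
  "(real^'n \<Rightarrow> real^'n) \<Rightarrow> (real^'n \<Rightarrow> real^'n^'p) \<Rightarrow> (real^'n \<Rightarrow> real^'m^'n) \<Rightarrow>
   (real^'n \<Rightarrow> real^'n) \<Rightarrow> (real \<Rightarrow> real) \<Rightarrow>
   (real^'n \<Rightarrow> real) \<Rightarrow> (real^'n \<Rightarrow> real^'n) \<Rightarrow> (real \<Rightarrow> real) \<Rightarrow>
   real^'p \<Rightarrow> real^'n \<Rightarrow> real^('m option) \<Rightarrow> bool" where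
  "qp_feasible f \<phi> g DV \<alpha>3 h Dh \<alpha>4 \<theta>h x v \<longleftrightarrow>
     DV x \<bullet> sys_rhs f \<phi> g \<theta>h x (u_part v) + \<alpha>3 (norm x) \<le> slack v \<and>
     Dh x \<bullet> sys_rhs f \<phi> g \<theta>h x (u_part v) + \<alpha>4 (h x) \<ge> 0"

definition is_qp_control ::
  "(real^'n \<Rightarrow> real^'n) \<Rightarrow> (real^'n \<Rightarrow> real^'n^'p) \<Rightarrow> (real^'n \<Rightarrow> real^'m^'n) \<Rightarrow>
   (real^'n \<Rightarrow> real^'n) \<Rightarrow> (real \<Rightarrow> real) \<Rightarrow>
   (real^'n \<Rightarrow> real) \<Rightarrow> (real^'n \<Rightarrow> real^'n) \<Rightarrow> (real \<Rightarrow> real) \<Rightarrow>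
   (real^'n \<Rightarrow> real^('m option)^('m option)) \<Rightarrow> (real^'n \<Rightarrow> real^('m option)) \<Rightarrow>
   real^'p \<Rightarrow> real^'n \<Rightarrow> real^'m \<Rightarrow> bool" where
  "is_qp_control f \<phi> g DV \<alpha>3 h Dh \<alpha>4 H F \<theta>h x u \<longleftrightarrow>
     (\<exists>v. is_arg_min (qp_cost (H x) (F x)) (qp_feasible f \<phi> g DV \<alpha>3 h Dh \<alpha>4 \<theta>h x) v
        \<and> u = u_part v)"

(* The library integral over {s..t} is 0 for t < s; the data below need the orientation. *)
definition oriented_integral :: "real \<Rightarrow> real \<Rightarrow> (real \<Rightarrow> 'a::real_normed_vector) \<Rightarrow> 'a" where
  "oriented_integral s t w = (if s \<le> t then integral {s..t} w else - integral {t..s} w)"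

definition data_p ::
  "(real^'n \<Rightarrow> real^'n) \<Rightarrow> (real^'n \<Rightarrow> real^'m^'n) \<Rightarrow> (real \<Rightarrow> real^'n) \<Rightarrow> (real \<Rightarrow> real^'m) \<Rightarrow>
   real \<Rightarrow> real \<Rightarrow> real^'n" where
  "data_p f g x u t s = x t - x s - oriented_integral s t (\<lambda>r. f (x r) + g (x r) *v u r)"

definition data_q ::
  "(real^'n \<Rightarrow> real^'n^'p) \<Rightarrow> (real \<Rightarrow> real^'n) \<Rightarrow> real \<Rightarrow> real \<Rightarrow> real^'p^'n" where
  "data_q \<phi> x t s = oriented_integral s t (\<lambda>r. transpose (\<phi> (x r)))"

definition data_G :: "(real^'n \<Rightarrow> real^'n^'p) \<Rightarrow> (real \<Rightarrow> real^'n) \<Rightarrow> real \<Rightarrow> real^'p^'p" where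
  "data_G \<phi> x T =
     integral {0..T} (\<lambda>t. integral {0..T} (\<lambda>s. transpose (data_q \<phi> x t s) ** data_q \<phi> x t s))"

definition data_Z ::
  "(real^'n \<Rightarrow> real^'n) \<Rightarrow> (real^'n \<Rightarrow> real^'n^'p) \<Rightarrow> (real^'n \<Rightarrow> real^'m^'n) \<Rightarrow>
   (real \<Rightarrow> real^'n) \<Rightarrow> (real \<Rightarrow> real^'m) \<Rightarrow> real \<Rightarrow> real^'p" where
  "data_Z f \<phi> g x u T =
     integral {0..T} (\<lambda>t. integral {0..T} (\<lambda>s. transpose (data_q \<phi> x t s) *v data_p f g x u t s))"

(* Levels are numbered from 1; the value at 0 is irrelevant. *)
fun chi_level :: "real \<Rightarrow> real \<Rightarrow> real \<Rightarrow> real \<Rightarrow> nat \<Rightarrow> real" where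
  "chi_level \<chi>bar \<gamma>0 \<gamma>1 h0 (Suc 0) = min \<chi>bar (\<gamma>0 * h0)"
| "chi_level \<chi>bar \<gamma>0 \<gamma>1 h0 (Suc (Suc i)) = \<gamma>1 * chi_level \<chi>bar \<gamma>0 \<gamma>1 h0 (Suc i)"

definition time_dom :: "ereal \<Rightarrow> real set" where
  "time_dom T = {t. 0 \<le> t \<and> ereal t < T}"

(* y is the signal h(x(t)), which exists on J only; c is the sequence of levels. If J ends before
   the next trigger, the recursion yields a time outside J, which does not count as an update. *)
primrec trigger_time ::
  "real set \<Rightarrow> (real \<Rightarrow> real) \<Rightarrow> (nat \<Rightarrow> real) \<Rightarrow> real \<Rightarrow> nat \<Rightarrow> real" where
  "trigger_time J y c \<Delta> 0 = 0"
| "trigger_time J y c \<Delta> (Suc i) =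
     (LEAST t. t \<in> J \<and> trigger_time J y c \<Delta> i < t \<and> y t = c (Suc i)
             \<or> t = trigger_time J y c \<Delta> i + \<Delta>)"

(* The state equation in integral form. As has_integral is the Henstock-Kurzweil integral, this
   covers classical solutions (continuous, differentiable except at countably many times) as
   well as Caratheodory solutions. *)
definition is_trajectory ::
  "(real^'n) set \<Rightarrow> (real^'n \<Rightarrow> real^'n) \<Rightarrow> (real^'n \<Rightarrow> real^'n^'p) \<Rightarrow> (real^'n \<Rightarrow> real^'m^'n) \<Rightarrow>
   real^'p \<Rightarrow> real set \<Rightarrow> (real \<Rightarrow> real^'n) \<Rightarrow> (real \<Rightarrow> real^'m) \<Rightarrow> bool" where
  "is_trajectory X f \<phi> g \<theta> J x u \<longleftrightarrow>
     (\<forall>t\<in>J. x t \<in> X \<and> ((\<lambda>r. sys_rhs f \<phi> g \<theta> (x r) (u r)) has_integral (x t - x 0)) {0..t})"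

definition is_batch_ls_update ::
  "(real^'n \<Rightarrow> real^'n) \<Rightarrow> (real^'n \<Rightarrow> real^'n^'p) \<Rightarrow> (real^'n \<Rightarrow> real^'m^'n) \<Rightarrow> real set \<Rightarrow>
   (nat \<Rightarrow> real) \<Rightarrow> (real \<Rightarrow> real^'n) \<Rightarrow> (real \<Rightarrow> real^'m) \<Rightarrow> (real \<Rightarrow> real^'p) \<Rightarrow> bool" where
  "is_batch_ls_update f \<phi> g J \<tau> x u \<theta>h \<longleftrightarrow>
     (\<forall>i\<ge>1. \<tau> i \<in> J \<longrightarrow>
        is_arg_min (\<lambda>w. (norm (w - \<theta>h (\<tau> (i - 1))))\<^sup>2)
          (\<lambda>w. data_Z f \<phi> g x u (\<tau> i) = data_G \<phi> x (\<tau> i) *v w) (\<theta>h (\<tau> i))) \<and>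
     (\<forall>i. \<forall>t\<in>J. \<tau> i \<le> t \<and> t < \<tau> (i + 1) \<longrightarrow> \<theta>h t = \<theta>h (\<tau> i))"

definition is_closed_loop_solution ::
  "(real^'n) set \<Rightarrow> (real^'n \<Rightarrow> real^'n) \<Rightarrow> (real^'n \<Rightarrow> real^'n^'p) \<Rightarrow> (real^'n \<Rightarrow> real^'m^'n) \<Rightarrow>
   real^'p \<Rightarrow> (real^'n \<Rightarrow> real^'n) \<Rightarrow> (real \<Rightarrow> real) \<Rightarrow>
   (real^'n \<Rightarrow> real) \<Rightarrow> (real^'n \<Rightarrow> real^'n) \<Rightarrow> (real \<Rightarrow> real) \<Rightarrow>
   (real^'n \<Rightarrow> real^('m option)^('m option)) \<Rightarrow> (real^'n \<Rightarrow> real^('m option)) \<Rightarrow>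
   real set \<Rightarrow> (nat \<Rightarrow> real) \<Rightarrow>
   (real \<Rightarrow> real^'n) \<Rightarrow> (real \<Rightarrow> real^'m) \<Rightarrow> (real \<Rightarrow> real^'p) \<Rightarrow> bool" where
  "is_closed_loop_solution X f \<phi> g \<theta> DV \<alpha>3 h Dh \<alpha>4 H F J \<tau> x u \<theta>h \<longleftrightarrow>
     is_trajectory X f \<phi> g \<theta> J x u \<and>
     (\<forall>t\<in>J. is_qp_control f \<phi> g DV \<alpha>3 h Dh \<alpha>4 H F (\<theta>h t) (x t) (u t)) \<and>
     is_batch_ls_update f \<phi> g J \<tau> x u \<theta>h"

definition is_Zeno :: "real set \<Rightarrow> (nat \<Rightarrow> real) \<Rightarrow> bool" where
  "is_Zeno J \<tau> \<longleftrightarrow> (\<exists>a b :: real. infinite {i. 1 \<le> i \<and> \<tau> i \<in> J \<and> \<tau> i \<in> {a..b}})"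

end

theory Submission
  imports Defs
begin

text \<open>
  The least squares estimate satisfies \<open>G(\<tau>\<^sub>i) (\<theta>h(\<tau>\<^sub>i) - \<theta>) = 0\<close>, and the null space of \<open>G(\<tau>\<^sub>i)\<close>
  consists of the \<open>w\<close> with \<open>\<phi>(x(r))\<^sup>T w = 0\<close> for all \<open>r \<le> \<tau>\<^sub>i\<close>. These null spaces decrease, so from some
  index on they agree; between two later updates the estimation error is therefore invisible along
  the trajectory, and the barrier constraint of the controller holds for the true \<open>\<theta>\<close>, that is
  \<open>d/dt h(x(t)) \<ge> - \<alpha>4(h(x(t)))\<close>. Since \<open>\<alpha>4(y) \<le> y / \<sigma>\<close>, the descent of \<open>h(x(t))\<close> from its last visit to
  level \<open>\<chi>\<^sub>i\<close> down to \<open>\<chi>\<^sub>i\<^sub>+\<^sub>1 = \<gamma>1 \<chi>\<^sub>i\<close> has speed at most \<open>\<chi>\<^sub>i / \<sigma>\<close> and takes at least the time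
  \<open>\<sigma> (1 - \<gamma>1)\<close>, which is independent of \<open>i\<close>.
\<close>

section \<open>Descent of a function along an integral curve\<close>

text \<open>Henstock's lemma, with the sum of errors packed into an increment: \<open>\<mu> t\<close> is the supremum of the
  Riemann sum errors over fine partial divisions of \<open>{a..t}\<close>.\<close>

lemma henstock_variation:
  fixes w :: "real \<Rightarrow> 'a::euclidean_space"
  assumes w: "w integrable_on {a..b}" and e: "0 < e"
  obtains \<mu> \<gamma> where "gauge \<gamma>" "\<And>t. t \<in> {a..b} \<Longrightarrow> 0 \<le> \<mu> t \<and> \<mu> t \<le> e"
    "\<And>c d r. \<lbrakk>a \<le> c; c \<le> d; d \<le> b; r \<in> {c..d}; {c..d} \<subseteq> \<gamma> r\<rbrakk>
       \<Longrightarrow> norm (integral {c..d} w - (d - c) *\<^sub>R w r) \<le> \<mu> d - \<mu> c"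
proof -
  from w have w': "w integrable_on cbox a b" by simp
  obtain \<gamma> where g: "gauge \<gamma>" and
    hen: "\<And>p. \<lbrakk>p tagged_partial_division_of (cbox a b); \<gamma> fine p\<rbrakk> \<Longrightarrow>
             sum (\<lambda>(x,k). norm(measure lborel k *\<^sub>R w x - integral k w)) p < e"
    proof (rule Henstock_lemma[OF w' e])
    fix \<gamma> :: "real \<Rightarrow> real set"
    assume "gauge \<gamma>" and "\<And>p. \<lbrakk>p tagged_partial_division_of (cbox a b); \<gamma> fine p\<rbrakk> \<Longrightarrow>
             sum (\<lambda>(x,k). norm(measure lborel k *\<^sub>R w x - integral k w)) p < e"
    then show thesis by (rule that)
  qed
  define S where "S p = sum (\<lambda>(x,k). norm(measure lborel k *\<^sub>R w x - integral k w)) p" for p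
  define D where "D t = {p. p tagged_partial_division_of {a..t} \<and> \<gamma> fine p}" for t
  define \<mu> where "\<mu> t = Sup (S ` D t)" for t
  \<comment> \<open>The empty division makes the set under each supremum nonempty and gives
    \<open>0 \<le> \<mu> t\<close>, since its error sum is 0.\<close>
  have empty: "{} \<in> D t" for t
    by (auto simp: D_def tagged_partial_division_of_def fine_def)
  have S_le: "S p < e" if "p \<in> D t" "t \<le> b" for p t
  proof -
    have "{a..t} \<subseteq> {a..b}" using that by auto
    with that(1) have "p tagged_partial_division_of {a..b}"
      unfolding D_def tagged_partial_division_of_def by blast
    with that hen show ?thesis by (auto simp: S_def D_def)
  qed
  have bdd: "bdd_above (S ` D t)" if "t \<le> b" for t
    using S_le[OF _ that] by (force intro!: bdd_aboveI[where M = e] less_imp_le)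
  have "0 \<le> \<mu> t \<and> \<mu> t \<le> e" if "t \<in> {a..b}" for t
  proof
    have "S {} \<le> \<mu> t" unfolding \<mu>_def
      using that empty by (intro cSup_upper bdd) auto
    then show "0 \<le> \<mu> t" by (simp add: S_def)
    show "\<mu> t \<le> e" unfolding \<mu>_def
      using S_le[of _ t] that empty[of t] by (intro cSup_least) (auto intro: less_imp_le)
  qed
  moreover have "norm (integral {c..d} w - (d - c) *\<^sub>R w r) \<le> \<mu> d - \<mu> c"
    if cd: "a \<le> c" "c \<le> d" "d \<le> b" "r \<in> {c..d}" "{c..d} \<subseteq> \<gamma> r" for c d r
  proof (cases "c = d")
    case False
    with cd have less: "c < d" by simp
    let ?E = "norm ((d - c) *\<^sub>R w r - integral {c..d} w)"
    \<comment> \<open>Adding the tagged interval \<open>(r, {c..d})\<close> to a fine partial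
      division of \<open>{a..c}\<close> yields one of \<open>{a..d}\<close>, whose error sum is
      larger by exactly \<open>?E\<close>.\<close>
    have "\<mu> c \<le> \<mu> d - ?E" unfolding \<mu>_def[of c]
    proof (rule cSup_least)
      fix y assume "y \<in> S ` D c"
      then obtain p where p: "p tagged_partial_division_of {a..c}" "\<gamma> fine p" and y: "y = S p"
        by (auto simp: D_def)
      note pD = tagged_partial_division_ofD[OF p(1)]
      \<comment> \<open>As \<open>c < d\<close>, the interval \<open>{c..d}\<close> does not fit
        into \<open>{a..c}\<close>; hence the sum over the enlarged division splits.\<close>
      have notin: "(r, {c..d}) \<notin> p"
        using pD(3)[of r "{c..d}"] less by auto
      have disj: "interior K \<inter> interior {c..d} = {}" if "(z, K) \<in> p" for z K
      proof -
        have "interior K \<subseteq> interior {a..c}" using pD(3)[OF that] by (rule interior_mono)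
        then show ?thesis by auto
      qed
      have "insert (r, {c..d}) p tagged_partial_division_of {a..d}"
        unfolding tagged_partial_division_of_def
      proof (intro conjI allI impI)
        show "finite (insert (r, {c..d}) p)" using pD(1) by simp
      next
        fix z K assume zK: "(z, K) \<in> insert (r, {c..d}) p"
        show "z \<in> K" using zK cd pD(2) by auto
        show "K \<subseteq> {a..d}" using zK cd pD(3)[of z K] by force
        show "\<exists>a b. K = cbox a b" using zK pD(4)[of z K] by (metis box_real(2) insertE prod.inject)
      next
        fix z1 K1 z2 K2
        assume "(z1, K1) \<in> insert (r, {c..d}) p \<and> (z2, K2) \<in> insert (r, {c..d}) p
          \<and> (z1, K1) \<noteq> (z2, K2)"
        then show "interior K1 \<inter> interior K2 = {}"
          using disj pD(5) by (metis Int_commute insertE prod.inject)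
      qed
      moreover have "\<gamma> fine insert (r, {c..d}) p"
        using p(2) cd(5) by (auto simp: fine_def)
      ultimately have "insert (r, {c..d}) p \<in> D d" by (simp add: D_def)
      then have "S (insert (r, {c..d}) p) \<le> \<mu> d"
        unfolding \<mu>_def using cd(3) by (intro cSup_upper bdd) auto
      moreover have "S (insert (r, {c..d}) p) = ?E + S p"
        using notin pD(1) less by (simp add: S_def)
      ultimately show "y \<le> \<mu> d - ?E" using y by simp
    qed (use empty in auto)
    then show ?thesis by (simp add: norm_minus_commute)
  qed simp
  ultimately show ?thesis using that g by blast
qed

text \<open>The curve \<open>x\<close> need not be differentiable everywhere, nor of bounded variation. Adding
  a small multiple of the error function \<open>\<mu>\<close> makes \<open>h (x t) + m * t\<close> nondecreasing near every point.\<close>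

lemma decrease_along_integral_curve:
  fixes x w :: "real \<Rightarrow> 'a::euclidean_space"
  assumes ab: "a \<le> b"
    and w: "\<And>t. t \<in> {a..b} \<Longrightarrow> (w has_integral (x t - x a)) {a..t}"
    and X: "\<And>t. t \<in> {a..b} \<Longrightarrow> x t \<in> X"
    and h: "C1_on X h Dh"
    and m: "\<And>t. t \<in> {a..b} \<Longrightarrow> - m \<le> Dh (x t) \<bullet> w t"
  shows "h (x a) - m * (b - a) \<le> h (x b)"
proof -
  have int: "w integrable_on {a..b}" using w[of b] ab by auto
  have xeq: "x t = x a + integral {a..t} w" if "t \<in> {a..b}" for t
    using w[OF that] by (simp add: integral_unique)
  have contx: "continuous_on {a..b} x"
  proof -
    have "continuous_on {a..b} (\<lambda>t. x a + integral {a..t} w)"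
      by (intro continuous_intros indefinite_integral_continuous_1 int)
    then show ?thesis
      by (rule continuous_on_eq[of _ "\<lambda>t. x a + integral {a..t} w"]) (rule xeq[symmetric])
  qed
  have inc: "x d - x c = integral {c..d} w" if "a \<le> c" "c \<le> d" "d \<le> b" for c d
  proof -
    have "w integrable_on {a..d}" using w[of d] that by auto
    then show ?thesis
      using Henstock_Kurzweil_Integration.integral_combine[of a c d w] that xeq[of c] xeq[of d]
      by (simp add: algebra_simps)
  qed
  have "compact ((\<lambda>t. Dh (x t)) ` {a..b})"
  proof (rule compact_continuous_image)
    have "continuous_on X Dh" using h by (simp add: C1_on_def)
    then show "continuous_on {a..b} (\<lambda>t. Dh (x t))"
      using contx X by (auto intro: continuous_on_compose2)
  qed simp
  then obtain K where K: "\<And>t. t \<in> {a..b} \<Longrightarrow> norm (Dh (x t)) \<le> K"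
    using compact_imp_bounded by (fastforce simp: bounded_iff)
  have K0: "0 \<le> K" using order_trans[OF norm_ge_zero K[of a]] ab by simp
  \<comment> \<open>\<open>e\<close> is at once the tolerance in Henstock's lemma and the slack in
    the linearization; it tends to 0 at the end.\<close>
  have main: "h (x a) \<le> h (x b) + m * (b - a) + (K + 1) * e + e * (b - a)" if e: "0 < e" for e
  proof -
    obtain \<mu> \<gamma> where g: "gauge \<gamma>" and mu: "\<And>t. t \<in> {a..b} \<Longrightarrow> 0 \<le> \<mu> t \<and> \<mu> t \<le> e"
      and hen: "\<And>c d r. \<lbrakk>a \<le> c; c \<le> d; d \<le> b; r \<in> {c..d}; {c..d} \<subseteq> \<gamma> r\<rbrakk>
         \<Longrightarrow> norm (integral {c..d} w - (d - c) *\<^sub>R w r) \<le> \<mu> d - \<mu> c"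
      using henstock_variation[OF int e] by metis
    \<comment> \<open>In the weight \<open>K + 1\<close>, the \<open>K\<close> pays for the gradient
      applied to the Henstock error and the 1 for the share of that error in the linearization
      remainder. The term \<open>e * t\<close> pays for the rest of the remainder.\<close>
    define G where "G t = h (x t) + m * t + (K + 1) * \<mu> t + e * t" for t
    let ?P = "\<lambda>c d. a \<le> c \<and> d \<le> b \<longrightarrow> G c \<le> G d"
    have "?P a b"
    \<comment> \<open>Monotonicity of \<open>G\<close> passes to adjacent intervals, so it suffices
      to have it on all short intervals around each point \<open>r\<close>.\<close>
    proof (rule Bolzano[where P = ?P, OF ab], force)
      fix r assume "a \<le> r" "r \<le> b"
      then have r: "r \<in> {a..b}" by simp
      \<comment> \<open>The accuracy of the linearization depends on \<open>r\<close>, because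
        \<open>w\<close> may be unbounded: \<open>\<eta> * norm (w r)\<close> must stay below
        \<open>e\<close>.\<close>
      define \<eta> where "\<eta> = min 1 (e / (1 + norm (w r)))"
      have eta: "0 < \<eta>" "\<eta> \<le> 1" using e by (auto simp: \<eta>_def add_pos_nonneg)
      have "\<eta> * norm (w r) \<le> e / (1 + norm (w r)) * (1 + norm (w r))"
        using e by (intro mult_mono) (auto simp: \<eta>_def)
      also have "\<dots> = e"
        by (metis add_pos_nonneg less_numeral_extra(1) less_irrefl nonzero_eq_divide_eq norm_ge_zero)
      finally have etaw: "\<eta> * norm (w r) \<le> e" .
      have "(h has_derivative (\<lambda>v. Dh (x r) \<bullet> v)) (at (x r) within X)"
        using h X[OF r] by (simp add: C1_on_def)
      then obtain \<delta>0 where d0: "0 < \<delta>0" and der: "\<And>y. \<lbrakk>y \<in> X; norm (y - x r) < \<delta>0\<rbrakk> \<Longrightarrow>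
         \<bar>h y - h (x r) - Dh (x r) \<bullet> (y - x r)\<bar> \<le> \<eta> * norm (y - x r)"
        unfolding has_derivative_within_alt real_norm_def using eta(1) by blast
      obtain \<delta>1 where d1: "0 < \<delta>1"
        and near: "\<And>t. \<lbrakk>t \<in> {a..b}; dist t r < \<delta>1\<rbrakk> \<Longrightarrow> dist (x t) (x r) < \<delta>0"
        using contx r d0 unfolding continuous_on_iff by blast
      obtain \<delta>2 where d2: "0 < \<delta>2" and ball: "ball r \<delta>2 \<subseteq> \<gamma> r"
        using g unfolding gauge_def by (meson open_contains_ball)
      \<comment> \<open>\<open>y\<close> is the curve at the other end of an interval of length
        \<open>l\<close>, and \<open>z\<close> is the deviation of the increment from
        \<open>l *\<^sub>R w r\<close>. Both the remainder and the contribution of \<open>z\<close>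
        are absorbed by the extra terms of \<open>G\<close>.\<close>
      have step: "m * l + e * l + (K + 1) * (\<mu> d - \<mu> c) \<ge> \<bar>h y - h (x r) - Dh (x r) \<bullet> (y - x r)\<bar>
            + \<bar>Dh (x r) \<bullet> z\<bar> + m * l"
        if "norm z \<le> \<mu> d - \<mu> c" "y \<in> X" "norm (y - x r) < \<delta>0"
          "norm (y - x r) \<le> l * norm (w r) + norm z" "0 \<le> l"
        for l c d y z
      proof -
        have "\<eta> * norm (y - x r) \<le> l * (\<eta> * norm (w r)) + \<eta> * norm z"
          using mult_left_mono[OF that(4), of \<eta>] eta by (simp add: algebra_simps)
        also have "\<dots> \<le> l * e + (\<mu> d - \<mu> c)"
          using that eta etaw mult_right_mono[OF eta(2), of "norm z"]
          by (intro add_mono mult_left_mono) auto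
        finally have 1: "\<bar>h y - h (x r) - Dh (x r) \<bullet> (y - x r)\<bar> \<le> l * e + (\<mu> d - \<mu> c)"
          using der[OF that(2,3)] by linarith
        have "\<bar>Dh (x r) \<bullet> z\<bar> \<le> norm (Dh (x r)) * norm z" by (rule Cauchy_Schwarz_ineq2)
        also have "\<dots> \<le> K * (\<mu> d - \<mu> c)" using K[OF r] K0 that by (intro mult_mono) auto
        finally show ?thesis using 1 by (simp add: algebra_simps)
      qed
      \<comment> \<open>The expansion is centred at \<open>r\<close>, so intervals to the right and
        to the left of \<open>r\<close> are treated separately and joined through
        \<open>G r\<close>.\<close>
      have up: "G r \<le> G d" if d: "r \<le> d" "d \<le> b" "d - r < min \<delta>1 \<delta>2" for d
      proof -
        define z where "z = integral {r..d} w - (d - r) *\<^sub>R w r"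
        have xd: "x d - x r = (d - r) *\<^sub>R w r + z" using inc[of r d] r d by (simp add: z_def)
        have "{r..d} \<subseteq> \<gamma> r" using ball d by (auto simp: dist_real_def subset_iff)
        then have "norm z \<le> \<mu> d - \<mu> r" unfolding z_def using r d by (intro hen) auto
        moreover have "norm (x d - x r) \<le> (d - r) * norm (w r) + norm z"
          unfolding xd using norm_triangle_ineq[of "(d - r) *\<^sub>R w r" z] d by simp
        moreover have "norm (x d - x r) < \<delta>0"
          using near[of d] r d by (simp add: dist_norm)
        ultimately have "m * (d - r) + e * (d - r) + (K + 1) * (\<mu> d - \<mu> r)
           \<ge> \<bar>h (x d) - h (x r) - Dh (x r) \<bullet> (x d - x r)\<bar> + \<bar>Dh (x r) \<bullet> z\<bar> + m * (d - r)"
          using r d by (intro step X) auto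
        moreover have "Dh (x r) \<bullet> (x d - x r) = (d - r) * (Dh (x r) \<bullet> w r) + Dh (x r) \<bullet> z"
          by (simp add: xd inner_add_right inner_diff_right)
        moreover have "(d - r) * (Dh (x r) \<bullet> w r) \<ge> (d - r) * (- m)"
          using m[OF r] d by (intro mult_left_mono) auto
        ultimately show ?thesis unfolding G_def by (simp add: algebra_simps)
      qed
      have down: "G c \<le> G r" if c: "c \<le> r" "a \<le> c" "r - c < min \<delta>1 \<delta>2" for c
      proof -
        define z where "z = integral {c..r} w - (r - c) *\<^sub>R w r"
        have xd: "x c - x r = - ((r - c) *\<^sub>R w r + z)" using inc[of c r] r c by (simp add: z_def algebra_simps)
        have "{c..r} \<subseteq> \<gamma> r" using ball c by (auto simp: dist_real_def subset_iff)
        then have "norm z \<le> \<mu> r - \<mu> c" unfolding z_def using r c by (intro hen) auto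
        moreover have "norm (x c - x r) \<le> (r - c) * norm (w r) + norm z"
          unfolding xd norm_minus_cancel using norm_triangle_ineq[of "(r - c) *\<^sub>R w r" z] c by simp
        moreover have "norm (x c - x r) < \<delta>0"
          using near[of c] r c by (simp add: dist_norm)
        ultimately have "m * (r - c) + e * (r - c) + (K + 1) * (\<mu> r - \<mu> c)
           \<ge> \<bar>h (x c) - h (x r) - Dh (x r) \<bullet> (x c - x r)\<bar> + \<bar>Dh (x r) \<bullet> z\<bar> + m * (r - c)"
          using r c by (intro step X) auto
        moreover have "Dh (x r) \<bullet> (x c - x r) = - ((r - c) * (Dh (x r) \<bullet> w r) + Dh (x r) \<bullet> z)"
          by (simp add: xd inner_add_right inner_diff_right)
        moreover have "(r - c) * (Dh (x r) \<bullet> w r) \<ge> (r - c) * (- m)"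
          using m[OF r] c by (intro mult_left_mono) auto
        ultimately show ?thesis unfolding G_def by (simp add: algebra_simps)
      qed
      show "\<exists>\<delta>>0. \<forall>c d. c \<le> r \<and> r \<le> d \<and> d - c < \<delta> \<longrightarrow> a \<le> c \<and> d \<le> b \<longrightarrow> G c \<le> G d"
      proof (rule exI[of _ "min \<delta>1 \<delta>2"], intro conjI allI impI)
        show "0 < min \<delta>1 \<delta>2" using d1 d2 by simp
        fix c d assume "c \<le> r \<and> r \<le> d \<and> d - c < min \<delta>1 \<delta>2" "a \<le> c \<and> d \<le> b"
        then show "G c \<le> G d" using up[of d] down[of c] by auto
      qed
    qed
    then have "G a \<le> G b" by simp
    moreover have "(K + 1) * (\<mu> b - \<mu> a) \<le> (K + 1) * e"
      using mu[of a] mu[of b] ab K0 by (intro mult_left_mono) auto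
    ultimately show ?thesis unfolding G_def by (simp add: algebra_simps)
  qed
  have "h (x a) \<le> h (x b) + m * (b - a)"
  proof (rule field_le_epsilon)
    fix e :: real assume e: "0 < e"
    \<comment> \<open>Chosen so that the error terms \<open>(K + 1) * e' + e' * (b - a)\<close> add
      up to \<open>e\<close>.\<close>
    define e' where "e' = e / (K + 1 + (b - a))"
    have pos: "0 < K + 1 + (b - a)" using K0 ab by simp
    have "e' * (K + 1 + (b - a)) = e" using pos by (simp add: e'_def)
    then show "h (x a) \<le> h (x b) + m * (b - a) + e"
      using main[of e'] e pos by (simp add: e'_def[symmetric] algebra_simps) (simp add: e'_def)
  qed
  then show ?thesis by simp
qed

text \<open>As a simp rule it would turn \<open>transpose M *v w\<close> into \<open>w v* M\<close>,
  whereas the terms below are kept in the first form.\<close>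

declare transpose_matrix_vector [simp del]

section \<open>Data matrices and their null spaces\<close>

lemma oriented_integral_eq_diff:
  fixes A :: "real \<Rightarrow> 'a::banach"
  assumes A: "A integrable_on {0..T}" and t: "t \<in> {0..T}" "s \<in> {0..T}"
  shows "oriented_integral s t A = integral {0..t} A - integral {0..s} A"
proof -
  have *: "integral {c..d} A = integral {0..d} A - integral {0..c} A"
    if "0 \<le> c" "c \<le> d" "d \<le> T" for c d
  proof -
    have "A integrable_on {0..d}" using A that by (auto intro: integrable_subinterval_real)
    then show ?thesis
      using Henstock_Kurzweil_Integration.integral_combine[of 0 c d A] that by (simp add: algebra_simps)
  qed
  show ?thesis using *[of s t] *[of t s] t by (auto simp: oriented_integral_def)
qed

lemma bounded_linear_matrix_vector_mult_left: "bounded_linear (\<lambda>M :: real^'n^'m. M *v w)"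
  unfolding linear_conv_bounded_linear[symmetric]
  by (rule linearI) (simp_all add: matrix_vector_mult_add_rdistrib scaleR_matrix_vector_assoc)

lemma continuous_on_matrix_ops:
  "continuous_on S M \<Longrightarrow> continuous_on S v \<Longrightarrow> continuous_on S (\<lambda>z. (M z :: real^'n^'m) *v v z)"
  "continuous_on S M \<Longrightarrow> continuous_on S (\<lambda>z. transpose (M z :: real^'n^'m))"
  "continuous_on S M \<Longrightarrow> continuous_on S N
    \<Longrightarrow> continuous_on S (\<lambda>z. (M z :: real^'n^'m) ** (N z :: real^'k^'n))"
  by (simp_all add: matrix_vector_mult_def transpose_def matrix_matrix_mult_def
      continuous_on_vec_lambda)
   (auto intro!: continuous_intros continuous_on_vec_lambda)


lemma integral_eq_zero:
  fixes f :: "'a::euclidean_space \<Rightarrow> 'b::real_normed_vector"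
  assumes "\<And>t. t \<in> S \<Longrightarrow> f t = 0"
  shows "integral S f = 0"
  using integral_cong[of S f "\<lambda>_. 0"] assms by simp

lemma bounded_linear_double_integral:
  fixes M :: "real \<Rightarrow> real \<Rightarrow> 'a::banach"
  assumes L: "bounded_linear L" and M: "continuous_on ({a..b} \<times> {c..d}) (\<lambda>(t, s). M t s)"
  shows "L (integral {a..b} (\<lambda>t. integral {c..d} (M t)))
    = integral {a..b} (\<lambda>t. integral {c..d} (\<lambda>s. L (M t s)))"
proof -
  have "continuous_on {a..b} (\<lambda>t. integral (cbox c d) (M t))"
    using M by (intro integral_continuous_on_param) simp
  then have "(\<lambda>t. integral {c..d} (M t)) integrable_on {a..b}"
    by (simp add: integrable_continuous_real)
  from integral_linear[OF this L]
  have "L (integral {a..b} (\<lambda>t. integral {c..d} (M t))) = integral {a..b} (\<lambda>t. L (integral {c..d} (M t)))"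
    by (simp add: o_def)
  also have "\<dots> = integral {a..b} (\<lambda>t. integral {c..d} (\<lambda>s. L (M t s)))"
  proof (rule integral_cong)
    fix t assume t: "t \<in> {a..b}"
    have "continuous_on {c..d} (\<lambda>s. (\<lambda>(t, s). M t s) (t, s))"
      using t by (intro continuous_on_compose2[OF M] continuous_intros) auto
    then have "M t integrable_on {c..d}" by (simp add: integrable_continuous_real)
    from integral_linear[OF this L] show "L (integral {c..d} (M t)) = integral {c..d} (\<lambda>s. L (M t s))"
      by (simp add: o_def)
  qed
  finally show ?thesis .
qed

text \<open>The one-dimensional fact is applied twice: to the inner integral, which is continuous
  and nonnegative in \<open>t\<close>, and then to the section \<open>M t\<close>.\<close>

lemma double_integral_eq_0D:
  fixes M :: "real \<Rightarrow> real \<Rightarrow> real"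
  assumes M: "continuous_on ({a..b} \<times> {c..d}) (\<lambda>(t, s). M t s)"
    and nn: "\<And>t s. t \<in> {a..b} \<Longrightarrow> s \<in> {c..d} \<Longrightarrow> 0 \<le> M t s"
    and 0: "integral {a..b} (\<lambda>t. integral {c..d} (M t)) = 0"
    and less: "a < b" "c < d" and ts: "t \<in> {a..b}" "s \<in> {c..d}"
  shows "M t s = 0"
proof -
  have "continuous_on {a..b} (\<lambda>t. integral (cbox c d) (M t))"
    using M by (intro integral_continuous_on_param) simp
  then have "continuous_on {a..b} (\<lambda>t. integral {c..d} (M t))" by simp
  moreover have M': "continuous_on {c..d} (M t)" if "t \<in> {a..b}" for t
  proof -
    have "continuous_on {c..d} (\<lambda>s. (\<lambda>(t, s). M t s) (t, s))"
      using that by (intro continuous_on_compose2[OF M] continuous_intros) auto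
    then show ?thesis by simp
  qed
  moreover have "0 \<le> integral {c..d} (M t)" if "t \<in> {a..b}" for t
    using that M' nn by (intro integral_nonneg integrable_continuous_real) auto
  ultimately have "integral {c..d} (M t) = 0"
    using integral_eq_0_iff[of a b "\<lambda>t. integral {c..d} (M t)"] less ts 0 by blast
  with integral_eq_0_iff[of c d "M t"] M' nn less ts show ?thesis by blast
qed

lemma data_q_eq_diff:
  assumes "continuous_on {0..T} (\<lambda>r. \<phi> (x r))" and "t \<in> {0..T}" "s \<in> {0..T}"
  shows "data_q \<phi> x t s
    = integral {0..t} (\<lambda>r. transpose (\<phi> (x r))) - integral {0..s} (\<lambda>r. transpose (\<phi> (x r)))"
  unfolding data_q_def using assms
  by (intro oriented_integral_eq_diff integrable_continuous_real continuous_on_matrix_ops)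

lemma continuous_on_data_q:
  assumes c: "continuous_on {0..T} (\<lambda>r. \<phi> (x r))"
  shows "continuous_on ({0..T} \<times> {0..T}) (\<lambda>z. data_q \<phi> x (fst z) (snd z))"
proof -
  let ?Q = "\<lambda>t. integral {0..t} (\<lambda>r. transpose (\<phi> (x r)))"
  have Q: "continuous_on {0..T} ?Q"
    by (intro indefinite_integral_continuous_1 integrable_continuous_real continuous_on_matrix_ops c)
  have "continuous_on ({0..T} \<times> {0..T}) (\<lambda>z. ?Q (fst z) - ?Q (snd z))"
    by (intro continuous_on_diff continuous_on_compose2[OF Q] continuous_intros) auto
  then show ?thesis
    by (rule continuous_on_eq) (auto simp: data_q_eq_diff[OF c])
qed

lemma data_G_mult_vec:
  assumes c: "continuous_on {0..T} (\<lambda>r. \<phi> (x r))"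
  shows "data_G \<phi> x T *v w = integral {0..T} (\<lambda>t. integral {0..T} (\<lambda>s.
    transpose (data_q \<phi> x t s) *v (data_q \<phi> x t s *v w)))"
  unfolding data_G_def
  by (subst bounded_linear_double_integral[OF bounded_linear_matrix_vector_mult_left])
     (auto simp: case_prod_unfold matrix_vector_mul_assoc
        intro!: continuous_on_matrix_ops continuous_on_data_q c)

lemma inner_transpose_mult:
  fixes M :: "real^'n^'m"
  shows "w \<bullet> (transpose M *v (M *v w)) = (norm (M *v w))\<^sup>2"
  by (simp add: power2_norm_eq_inner transpose_matrix_vector dot_lmul_matrix inner_commute[of w])

text \<open>Exhibits \<open>data_G\<close> as a Gram matrix: its quadratic form integrates a square,
  so a null vector is annihilated by every \<open>data_q \<phi> x t s\<close>.\<close>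

lemma inner_data_G:
  assumes c: "continuous_on {0..T} (\<lambda>r. \<phi> (x r))"
  shows "w \<bullet> (data_G \<phi> x T *v w)
    = integral {0..T} (\<lambda>t. integral {0..T} (\<lambda>s. (norm (data_q \<phi> x t s *v w))\<^sup>2))"
  unfolding data_G_mult_vec[OF c]
  by (subst bounded_linear_double_integral[OF bounded_linear_inner_right])
     (auto simp: case_prod_unfold inner_transpose_mult
        intro!: continuous_on_matrix_ops continuous_intros continuous_on_data_q c)

text \<open>The indefinite integral has derivative \<open>A r\<close> and is constantly 0;
  derivatives within a nondegenerate closed interval are unique, also at its end points.\<close>

lemma zero_if_indefinite_integral_zero:
  fixes A :: "real \<Rightarrow> 'a::euclidean_space"
  assumes A: "continuous_on {0..T} A" and "0 < T"
    and 0: "\<And>t. t \<in> {0..T} \<Longrightarrow> integral {0..t} A = 0" and r: "r \<in> {0..T}"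
  shows "A r = 0"
proof -
  have "((\<lambda>t. integral {0..t} A) has_vector_derivative A r) (at r within {0..T})"
    by (rule integral_has_vector_derivative[OF A r])
  then have 1: "((\<lambda>t. 0) has_vector_derivative A r) (at r within {0..T})"
    by (rule has_vector_derivative_transform[OF r 0[symmetric], rotated])
  have 2: "((\<lambda>t. 0) has_vector_derivative (0::'a)) (at r within {0..T})" by simp
  show ?thesis
    using vector_derivative_within_closed_interval[OF \<open>0 < T\<close> r 1]
      vector_derivative_within_closed_interval[OF \<open>0 < T\<close> r 2] by simp
qed

text \<open>Translates the algebraic condition on \<open>data_G\<close> into one along the
  trajectory: the quadratic form forces \<open>data_q \<phi> x t s *v w = 0\<close>, and
  differentiating in \<open>t\<close> recovers the integrand. Conversely, a vanishing integrand
  makes all these integrals vanish.\<close>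

lemma null_space_data_G:
  assumes c: "continuous_on {0..T} (\<lambda>r. \<phi> (x r))" and T: "0 < T"
  shows "data_G \<phi> x T *v w = 0 \<longleftrightarrow> (\<forall>r\<in>{0..T}. transpose (\<phi> (x r)) *v w = 0)"
proof -
  let ?Q = "\<lambda>t. integral {0..t} (\<lambda>r. transpose (\<phi> (x r)))"
  have cA: "continuous_on {0..T} (\<lambda>r. transpose (\<phi> (x r)))"
    by (intro continuous_on_matrix_ops c)
  have Q: "?Q t *v w = integral {0..t} (\<lambda>r. transpose (\<phi> (x r)) *v w)" if "t \<in> {0..T}" for t
  proof -
    have "continuous_on {0..t} (\<lambda>r. transpose (\<phi> (x r)))"
      using that by (intro continuous_on_subset[OF cA]) auto
    from integral_linear[OF integrable_continuous_real[OF this] bounded_linear_matrix_vector_mult_left]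
    show ?thesis by (simp add: o_def)
  qed
  show ?thesis
  proof
    assume "data_G \<phi> x T *v w = 0"
    then have "integral {0..T} (\<lambda>t. integral {0..T} (\<lambda>s. (norm (data_q \<phi> x t s *v w))\<^sup>2)) = 0"
      using inner_data_G[OF c, of w] by simp
    then have "(norm (data_q \<phi> x t s *v w))\<^sup>2 = 0" if "t \<in> {0..T}" "s \<in> {0..T}" for t s
      using that T
      by (intro double_integral_eq_0D[where t = t and s = s
            and M = "\<lambda>t s. (norm (data_q \<phi> x t s *v w))\<^sup>2"])
         (auto simp: case_prod_unfold
            intro!: continuous_on_matrix_ops continuous_intros continuous_on_data_q c)
    \<comment> \<open>With \<open>s = 0\<close> the matrix \<open>data_q\<close> is the indefinite
      integral itself.\<close>
    then have "data_q \<phi> x t 0 *v w = 0" if "t \<in> {0..T}" for t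
      using that by simp
    then have "integral {0..t} (\<lambda>r. transpose (\<phi> (x r)) *v w) = 0" if "t \<in> {0..T}" for t
      unfolding Q[OF that, symmetric] using that data_q_eq_diff[OF c that, of 0] by fastforce
    note int0 = this
    have cAw: "continuous_on {0..T} (\<lambda>r. transpose (\<phi> (x r)) *v w)"
      by (intro continuous_on_matrix_ops cA continuous_on_const)
    show "\<forall>r\<in>{0..T}. transpose (\<phi> (x r)) *v w = 0"
    proof
      fix r assume "r \<in> {0..T}"
      from zero_if_indefinite_integral_zero[OF cAw T int0 this] show "transpose (\<phi> (x r)) *v w = 0" .
    qed
  next
    assume z: "\<forall>r\<in>{0..T}. transpose (\<phi> (x r)) *v w = 0"
    have "?Q t *v w = 0" if "t \<in> {0..T}" for t
      unfolding Q[OF that] using z that by (intro integral_eq_zero) simp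
    then have "data_q \<phi> x t s *v w = 0" if "t \<in> {0..T}" "s \<in> {0..T}" for t s
      using that by (simp add: data_q_eq_diff[OF c] matrix_vector_mult_diff_rdistrib)
    then show "data_G \<phi> x T *v w = 0"
      unfolding data_G_mult_vec[OF c] by (intro integral_eq_zero) simp
  qed
qed

section \<open>Level crossings and trigger times\<close>

lemma last_crossing:
  fixes y :: "real \<Rightarrow> real"
  assumes y: "continuous_on {a..b} y" and ab: "a \<le> b" and "y b \<le> c" "c \<le> y a"
  obtains s where "s \<in> {a..b}" "y s = c" "\<And>r. r \<in> {s..b} \<Longrightarrow> y r \<le> c"
proof -
  \<comment> \<open>The visits to level \<open>c\<close> form a compact set, whose maximum is the
    crossing sought: a later value above \<open>c\<close> would force a still later visit by the
    intermediate value theorem.\<close>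
  define K where "K = {t \<in> {a..b}. y t = c}"
  have "K = {a..b} \<inter> y -` {c}" by (auto simp: K_def)
  moreover have "closed ({a..b} \<inter> y -` {c})" by (intro continuous_closed_preimage y) auto
  ultimately have "compact K"
    by (metis compact_Icc inf_commute closed_Int_compact inf.left_idem)
  moreover have "K \<noteq> {}" using IVT2'[of y b c a] assms by (auto simp: K_def)
  ultimately obtain s where s: "s \<in> K" and max: "\<And>t. t \<in> K \<Longrightarrow> t \<le> s"
    using compact_attains_sup by metis
  show thesis
  proof (rule that)
    show "s \<in> {a..b}" "y s = c" using s by (auto simp: K_def)
    fix r assume r: "r \<in> {s..b}"
    show "y r \<le> c"
    proof (rule ccontr)
      assume "\<not> y r \<le> c"
      moreover have "continuous_on {r..b} y"
        using r s by (intro continuous_on_subset[OF y]) (auto simp: K_def)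
      ultimately obtain t where "r \<le> t" "t \<le> b" "y t = c"
        using IVT2'[of y b c r] assms r by auto
      with max[of t] r s have "t = r" by (auto simp: K_def)
      with \<open>y t = c\<close> \<open>\<not> y r \<le> c\<close> show False by simp
    qed
  qed
qed

text \<open>The recursion step of \<open>trigger_time\<close>, detached so that it can be studied
  for an arbitrary start and level.\<close>

definition next_trigger :: "real set \<Rightarrow> (real \<Rightarrow> real) \<Rightarrow> real \<Rightarrow> real \<Rightarrow> real \<Rightarrow> real" where
  "next_trigger J y c \<Delta> s = (LEAST t. t \<in> J \<and> s < t \<and> y t = c \<or> t = s + \<Delta>)"

text \<open>The hypothesis \<open>c < y s\<close> excludes crossing times accumulating at \<open>s\<close>, for which
  \<open>LEAST\<close> would be unspecified.\<close>

lemma next_trigger: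
  assumes J: "\<forall>t\<in>J. {0..t} \<subseteq> J" and y: "\<forall>t\<in>J. continuous_on {0..t} y"
    and s: "0 \<le> s" "s \<in> J \<Longrightarrow> c < y s" and D: "0 < \<Delta>"
  defines "n \<equiv> next_trigger J y c \<Delta> s"
  shows "s < n" "n \<le> s + \<Delta>" "n \<in> J \<and> y n = c \<or> n = s + \<Delta>"
    "n \<in> J \<Longrightarrow> r \<in> {s..n} \<Longrightarrow> c \<le> y r"
proof -
  let ?P = "\<lambda>t. t \<in> J \<and> s < t \<and> y t = c \<or> t = s + \<Delta>"
  \<comment> \<open>The reals are not well-ordered, so \<open>LEAST\<close> says nothing until a
    minimum is exhibited: the first point of a compact set of crossings, or the timeout
    \<open>s + \<Delta>\<close>.\<close>
  have "\<exists>m. ?P m \<and> (\<forall>t. ?P t \<longrightarrow> m \<le> t)"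
  proof (cases "\<exists>t0\<in>J. s < t0 \<and> t0 \<le> s + \<Delta> \<and> y t0 = c")
    case True
    then obtain t0 where t0: "t0 \<in> J" "s < t0" "t0 \<le> s + \<Delta>" "y t0 = c" by auto
    then have sub: "{s..t0} \<subseteq> J" using bspec[OF J t0(1)] s by auto
    define K where "K = {t \<in> {s..t0}. y t = c}"
    have "K = {s..t0} \<inter> y -` {c}" by (auto simp: K_def)
    moreover have "closed ({s..t0} \<inter> y -` {c})"
      using s by (intro continuous_closed_preimage continuous_on_subset[OF bspec[OF y t0(1)]]) auto
    ultimately have "compact K"
      by (metis compact_Icc inf_commute closed_Int_compact inf.left_idem)
    moreover have "t0 \<in> K" using t0 by (simp add: K_def)
    ultimately obtain m where m: "m \<in> K" and min: "\<And>t. t \<in> K \<Longrightarrow> m \<le> t"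
      using compact_attains_inf by (metis empty_iff)
    have "s \<in> J" using sub t0 by auto
    \<comment> \<open>\<open>K\<close> includes the left end point to be closed; the minimum is not
      there because \<open>c < y s\<close>.\<close>
    with s m have "s \<noteq> m" by (auto simp: K_def)
    then have "?P m" using m sub by (auto simp: K_def)
    moreover have "m \<le> t" if "?P t" for t
    proof (cases "t \<le> t0")
      case True
      then show ?thesis using that min[of t] min[OF \<open>t0 \<in> K\<close>] t0 by (auto simp: K_def)
    next
      case False
      then show ?thesis using min[OF \<open>t0 \<in> K\<close>] by simp
    qed
    ultimately show ?thesis by blast
  next
    case False
    then show ?thesis using D by (intro exI[of _ "s + \<Delta>"]) force
  qed
  then obtain m where m: "?P m" and min: "\<And>t. ?P t \<Longrightarrow> m \<le> t" by blast
  have n: "n = m" unfolding n_def next_trigger_def using m min by (rule Least_equality)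
  show sn: "s < n" using m D n by auto
  show "n \<le> s + \<Delta>" using min n by auto
  show "n \<in> J \<and> y n = c \<or> n = s + \<Delta>" using m n by auto
  show "c \<le> y r" if nJ: "n \<in> J" and r: "r \<in> {s..n}"
  proof (rule ccontr)
    \<comment> \<open>A value below \<open>c\<close> would yield, by the intermediate value theorem,
      a crossing earlier than the first one.\<close>
    assume less: "\<not> c \<le> y r"
    have sub: "{s..n} \<subseteq> J" using bspec[OF J nJ] s by auto
    then have "s \<in> J" using sn by auto
    moreover have "continuous_on {s..r} y"
      using r s by (intro continuous_on_subset[OF bspec[OF y nJ]]) auto
    ultimately obtain t where t: "s \<le> t" "t \<le> r" "y t = c"
      using IVT2'[of y r c s] r s less by auto
    moreover have "t \<noteq> s" "t \<noteq> r" using t less s \<open>s \<in> J\<close> by auto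
    moreover have "t \<in> J" using t r sub by auto
    ultimately show False using min[of t] n r by auto
  qed
qed

lemma trigger_time_Suc:
  "trigger_time J y c \<Delta> (Suc i) = next_trigger J y (c (Suc i)) \<Delta> (trigger_time J y c \<Delta> i)"
  by (simp add: next_trigger_def)

text \<open>Supplies the hypothesis of \<open>next_trigger\<close> at every trigger: up to
  \<open>\<tau> (Suc i)\<close> the signal stays at or above \<open>c (Suc i)\<close>, which lies
  strictly above the next level.\<close>

lemma trigger_time_invariant:
  assumes J: "\<forall>t\<in>J. {0..t} \<subseteq> J" and y: "\<forall>t\<in>J. continuous_on {0..t} y" and D: "0 < \<Delta>"
    and c: "c 1 < y 0" "\<And>i. c (Suc (Suc i)) < c (Suc i)"
  defines "\<tau> \<equiv> trigger_time J y c \<Delta>"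
  shows "0 \<le> \<tau> i \<and> (\<tau> i \<in> J \<longrightarrow> c (Suc i) < y (\<tau> i))"
proof (induction i)
  case 0 then show ?case using c by (simp add: \<tau>_def)
next
  case (Suc i)
  then have inv: "0 \<le> \<tau> i" "\<tau> i \<in> J \<Longrightarrow> c (Suc i) < y (\<tau> i)" by auto
  note n = next_trigger[OF J y inv D]
  have "\<tau> i < \<tau> (Suc i)" unfolding \<tau>_def trigger_time_Suc by (rule n(1)[unfolded \<tau>_def])
  moreover from this have "\<tau> (Suc i) \<in> J \<Longrightarrow> c (Suc i) \<le> y (\<tau> (Suc i))"
    unfolding \<tau>_def trigger_time_Suc by (intro n(4)[unfolded \<tau>_def]) auto
  ultimately show ?case using Suc c(2)[of i] by auto
qed

lemma trigger_time_step:
  assumes J: "\<forall>t\<in>J. {0..t} \<subseteq> J" and y: "\<forall>t\<in>J. continuous_on {0..t} y" and D: "0 < \<Delta>"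
    and c: "c 1 < y 0" "\<And>i. c (Suc (Suc i)) < c (Suc i)"
  defines "\<tau> \<equiv> trigger_time J y c \<Delta>"
  shows "\<tau> i < \<tau> (Suc i)"
    "\<tau> (Suc i) \<in> J \<and> y (\<tau> (Suc i)) = c (Suc i) \<or> \<tau> (Suc i) = \<tau> i + \<Delta>"
    "\<tau> (Suc i) \<in> J \<Longrightarrow> r \<in> {\<tau> i..\<tau> (Suc i)} \<Longrightarrow> c (Suc i) \<le> y r"
proof -
  have inv: "0 \<le> \<tau> i" "\<tau> i \<in> J \<Longrightarrow> c (Suc i) < y (\<tau> i)"
    using trigger_time_invariant[OF J y D c, of i] by (auto simp: \<tau>_def)
  note n = next_trigger[OF J y inv D, folded trigger_time_Suc \<tau>_def]
  have eq: "\<tau> (Suc i) = next_trigger J y (c (Suc i)) \<Delta> (\<tau> i)"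
    by (simp add: \<tau>_def trigger_time_Suc del: trigger_time.simps)
  show "\<tau> i < \<tau> (Suc i)"
    "\<tau> (Suc i) \<in> J \<and> y (\<tau> (Suc i)) = c (Suc i) \<or> \<tau> (Suc i) = \<tau> i + \<Delta>"
    "\<tau> (Suc i) \<in> J \<Longrightarrow> r \<in> {\<tau> i..\<tau> (Suc i)} \<Longrightarrow> c (Suc i) \<le> y r"
    unfolding eq using n by auto
qed

section \<open>Stationary subspaces and sequences with gaps\<close>

lemma decreasing_subspaces_stationary:
  fixes N :: "nat \<Rightarrow> 'a::euclidean_space set"
  assumes "\<And>i. subspace (N i)" and dec: "\<And>i. N (Suc i) \<subseteq> N i"
  obtains k where "\<And>i. k \<le> i \<Longrightarrow> N (Suc i) = N i"
proof -
  \<comment> \<open>At an index of minimal dimension the dimension can drop no further, and nested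
    subspaces of equal dimension coincide.\<close>
  obtain k where k: "\<And>i. dim (N k) \<le> dim (N i)"
    using ex_has_least_nat[of "\<lambda>_. True" 0 "\<lambda>i. dim (N i)"] by auto
  have "N (Suc i) = N i" if "k \<le> i" for i
  proof (rule subspace_dim_equal)
    have "N i \<subseteq> N k" using lift_Suc_antimono_le[of N] dec that by blast
    then have "dim (N i) \<le> dim (N k)" by (rule dim_subset)
    then show "dim (N i) \<le> dim (N (Suc i))" using k[of "Suc i"] by simp
  qed (use assms in auto)
  with that show ?thesis by blast
qed

lemma unbounded_if_gap:
  fixes \<tau> :: "nat \<Rightarrow> real"
  assumes \<rho>: "0 < \<rho>" and gap: "\<And>i. k \<le> i \<Longrightarrow> \<tau> i + \<rho> \<le> \<tau> (Suc i)"
  shows "\<exists>i. b < \<tau> i"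
proof -
  have "\<tau> k + real j * \<rho> \<le> \<tau> (k + j)" for j
  proof (induction j)
    case (Suc j) then show ?case using gap[of "k + j"] by (simp add: algebra_simps)
  qed simp
  moreover obtain j where "b - \<tau> k < real j * \<rho>" using ex_less_of_nat_mult[OF \<rho>] by blast
  ultimately show ?thesis by (metis add_less_cancel_left diff_add_cancel add.commute less_le_trans)
qed

section \<open>Consequences of the state equation\<close>

lemma trajectory_has_integral:
  assumes traj: "is_trajectory X f \<phi> g \<theta> J x u" and J: "\<And>t. t \<in> J \<Longrightarrow> {0..t} \<subseteq> J"
    and st: "0 \<le> s" "s \<le> t" "t \<in> J"
  shows "((\<lambda>r. sys_rhs f \<phi> g \<theta> (x r) (u r)) has_integral (x t - x s)) {s..t}"
proof -
  let ?w = "\<lambda>r. sys_rhs f \<phi> g \<theta> (x r) (u r)"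
  have w: "(?w has_integral (x r - x 0)) {0..r}" if "r \<in> J" for r
    using traj that by (simp add: is_trajectory_def)
  have s: "s \<in> J" using J[OF st(3)] st by auto
  have int: "?w integrable_on {0..t}" using w[OF st(3)] by auto
  then have "?w integrable_on {s..t}" using st by (auto intro: integrable_subinterval_real)
  moreover have "integral {s..t} ?w = x t - x s"
    using Henstock_Kurzweil_Integration.integral_combine[OF st(1,2) int]
      integral_unique[OF w[OF s]] integral_unique[OF w[OF st(3)]] by (simp add: algebra_simps)
  ultimately show ?thesis by (metis integrable_integral)
qed

lemma continuous_on_trajectory:
  assumes traj: "is_trajectory X f \<phi> g \<theta> J x u" and t: "t \<in> J" and J: "{0..t} \<subseteq> J"
  shows "continuous_on {0..t} x"
proof -
  let ?w = "\<lambda>r. sys_rhs f \<phi> g \<theta> (x r) (u r)"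
  have w: "(?w has_integral (x r - x 0)) {0..r}" if "r \<in> J" for r
    using traj that by (simp add: is_trajectory_def)
  have "?w integrable_on {0..t}" using w[OF t] by auto
  then have "continuous_on {0..t} (\<lambda>r. x 0 + integral {0..r} ?w)"
    by (intro continuous_intros indefinite_integral_continuous_1)
  then show ?thesis
  proof (rule continuous_on_eq)
    fix r assume "r \<in> {0..t}"
    then have "r \<in> J" using J by auto
    then show "x 0 + integral {0..r} ?w = x r" using integral_unique[OF w] by simp
  qed
qed

text \<open>Integrating the state equation gives
  \<open>data_p f g x u t s = data_q \<phi> x t s *v \<theta>\<close>. Thus the true parameter
  satisfies the constraint of the least squares problem.\<close>

lemma data_Z_eq_data_G_mult:
  assumes traj: "is_trajectory X f \<phi> g \<theta> J x u" and J: "{0..T} \<subseteq> J" and T: "0 \<le> T"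
    and c: "continuous_on {0..T} (\<lambda>r. \<phi> (x r))"
  shows "data_Z f \<phi> g x u T = data_G \<phi> x T *v \<theta>"
proof -
  let ?w = "\<lambda>r. sys_rhs f \<phi> g \<theta> (x r) (u r)"
  let ?A = "\<lambda>r. transpose (\<phi> (x r))"
  let ?v = "\<lambda>r. f (x r) + g (x r) *v u r"
  have w: "(?w has_integral (x r - x 0)) {0..r}" if "r \<in> {0..T}" for r
    using traj that J by (auto simp: is_trajectory_def)
  \<comment> \<open>No regularity of \<open>u\<close> is assumed; \<open>?v\<close> is integrable as
    the difference of the right-hand side and a continuous function.\<close>
  have v: "?v = (\<lambda>r. ?w r - ?A r *v \<theta>)" by (simp add: sys_rhs_def)
  have cA: "continuous_on {0..T} ?A" by (intro continuous_on_matrix_ops c)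
  have Aint: "((\<lambda>r. ?A r *v \<theta>) has_integral integral {0..t} ?A *v \<theta>) {0..t}" if "t \<in> {0..T}" for t
  proof -
    have "continuous_on {0..t} ?A" using that by (intro continuous_on_subset[OF cA]) auto
    then have "(?A has_integral integral {0..t} ?A) {0..t}"
      by (intro integrable_integral integrable_continuous_real)
    from has_integral_linear[OF this bounded_linear_matrix_vector_mult_left] show ?thesis
      by (simp add: o_def)
  qed
  have vint: "(?v has_integral x t - x 0 - integral {0..t} ?A *v \<theta>) {0..t}" if "t \<in> {0..T}" for t
    unfolding v by (intro has_integral_diff w Aint that)
  have p: "data_p f g x u t s = data_q \<phi> x t s *v \<theta>" if "t \<in> {0..T}" "s \<in> {0..T}" for t s
  proof -
    have "?v integrable_on {0..T}" using vint[of T] T by auto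
    then have "oriented_integral s t ?v = integral {0..t} ?v - integral {0..s} ?v"
      using that by (intro oriented_integral_eq_diff)
    also have "\<dots> = x t - x s - data_q \<phi> x t s *v \<theta>"
      using integral_unique[OF vint[OF that(1)]] integral_unique[OF vint[OF that(2)]]
      by (simp add: data_q_eq_diff[OF c that] matrix_vector_mult_diff_rdistrib)
    finally show ?thesis by (simp add: data_p_def)
  qed
  show ?thesis
    unfolding data_Z_def data_G_mult_vec[OF c] using p by (intro integral_cong) simp
qed

theorem theorem2:
  fixes X :: "(real^'n) set"
    and f :: "real^'n \<Rightarrow> real^'n"
    and \<phi> :: "real^'n \<Rightarrow> real^'n^'p"
    and g :: "real^'n \<Rightarrow> real^'m^'n"
    and \<theta> :: "real^'p"
    and V h :: "real^'n \<Rightarrow> real"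
    and DV Dh :: "real^'n \<Rightarrow> real^'n"
    and \<alpha>3 \<alpha>4 :: "real \<Rightarrow> real"
    and a3 a4 b4 :: ereal
    and H :: "real^'n \<Rightarrow> real^('m option)^('m option)"
    and F :: "real^'n \<Rightarrow> real^('m option)"
    and \<epsilon> \<chi>bar \<sigma> \<gamma>0 \<gamma>1 \<Delta>\<tau>max :: real
    and T :: ereal
    and x :: "real \<Rightarrow> real^'n"
    and u :: "real \<Rightarrow> real^'m"
    and \<theta>h :: "real \<Rightarrow> real^'p"
    and \<tau> :: "nat \<Rightarrow> real"
  assumes X: "path_connected X" "0 \<in> X"
    and lipschitz: "locally_lipschitz_on X f" "locally_lipschitz_on X \<phi>" "locally_lipschitz_on X g"
    and CLF: "is_CLF X f \<phi> g \<theta> V DV a3 \<alpha>3"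
    and ZCBF: "is_ZCBF X f \<phi> g \<theta> h Dh b4 a4 \<alpha>4"
    and H: "\<forall>z\<in>X. pos_def (H z)"
    and init: "0 < \<epsilon>" "h (x 0) > \<epsilon>"
    and ratio: "0 < \<chi>bar" "ereal \<chi>bar < a4" "0 < \<sigma>" "\<forall>y\<in>{0<..\<chi>bar}. y / \<alpha>4 y \<ge> \<sigma>"
    and design: "0 < \<gamma>0" "\<gamma>0 < 1" "0 < \<gamma>1" "\<gamma>1 < 1" "0 < \<Delta>\<tau>max"
    and T: "0 < T"
    and \<tau>: "\<tau> = trigger_time (time_dom T) (\<lambda>t. h (x t)) (chi_level \<chi>bar \<gamma>0 \<gamma>1 (h (x 0))) \<Delta>\<tau>max"
    and solution: "is_closed_loop_solution X f \<phi> g \<theta> DV \<alpha>3 h Dh \<alpha>4 H F (time_dom T) \<tau> x u \<theta>h"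
  shows "\<not> is_Zeno (time_dom T) \<tau>"
proof

  \<comment> \<open>Regularity of the closed-loop signals\<close>
  define J where "J = time_dom T"
  define c where "c = chi_level \<chi>bar \<gamma>0 \<gamma>1 (h (x 0))"
  define y where "y t = h (x t)" for t
  have tau: "\<tau> = trigger_time J y c \<Delta>\<tau>max" unfolding \<tau> J_def c_def y_def ..
  have J: "{0..t} \<subseteq> J" if "t \<in> J" for t
    using that by (auto simp: J_def time_dom_def) (metis ereal_less_eq(3) le_less_trans)
  have J_nonneg: "0 \<le> t" if "t \<in> J" for t using that by (simp add: J_def time_dom_def)
  have traj: "is_trajectory X f \<phi> g \<theta> J x u"
    and qp: "\<And>t. t \<in> J \<Longrightarrow> is_qp_control f \<phi> g DV \<alpha>3 h Dh \<alpha>4 H F (\<theta>h t) (x t) (u t)"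
    and ls: "is_batch_ls_update f \<phi> g J \<tau> x u \<theta>h"
    using solution by (auto simp: is_closed_loop_solution_def J_def)
  have xX: "x t \<in> X" if "t \<in> J" for t using traj that by (simp add: is_trajectory_def)
  have h: "C1_on X h Dh" using ZCBF by (simp add: is_ZCBF_def)
  have h_cont: "continuous_on X h"
    using h by (auto simp: C1_on_def continuous_on_eq_continuous_within intro: has_derivative_continuous)
  have \<phi>_cont: "continuous_on X \<phi>"
    using local_lipschitz_continuous_on[of UNIV X "\<lambda>_. \<phi>" 0] lipschitz(2)
    by (simp add: locally_lipschitz_on_def)
  have x_cont: "continuous_on {0..t} x" if "t \<in> J" for t
    using continuous_on_trajectory[OF traj that J[OF that]] .
  have \<phi>x: "continuous_on {0..t} (\<lambda>r. \<phi> (x r))" if "t \<in> J" for t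
    using continuous_on_compose2[OF \<phi>_cont x_cont[OF that]] xX J[OF that] by blast
  have y_cont: "continuous_on {0..t} y" if "t \<in> J" for t
    unfolding y_def using continuous_on_compose2[OF h_cont x_cont[OF that]] xX J[OF that] by blast

  \<comment> \<open>The levels\<close>
  have c_Suc: "c (Suc (Suc i)) = \<gamma>1 * c (Suc i)" for i by (simp add: c_def)
  have c1: "c 1 = min \<chi>bar (\<gamma>0 * h (x 0))" by (simp add: c_def)
  have h0: "0 < h (x 0)" using init by simp
  \<comment> \<open>Levels are numbered from 1 and \<open>c 0\<close> is unspecified, hence
    \<open>Suc i\<close> here and below.\<close>
  have c_pos: "0 < c (Suc i)" for i
  proof (induction i)
    case 0 then show ?case using c1 ratio design h0 by simp
  qed (use c_Suc design in simp)
  have c_dec: "c (Suc (Suc i)) < c (Suc i)" for i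
    using mult_strict_right_mono[OF design(4) c_pos[of i]] by (simp add: c_Suc)
  have c_le: "c (Suc i) \<le> \<chi>bar" for i
  proof (induction i)
    case 0 then show ?case using c1 by simp
  next
    case (Suc i) then show ?case using c_dec[of i] by linarith
  qed
  \<comment> \<open>\<open>\<gamma>0 < 1\<close> puts the first level strictly below the initial
    value, which starts the induction on triggers.\<close>
  have c1_less: "c 1 < y 0"
    using mult_strict_right_mono[OF design(2) h0] unfolding c1 y_def by simp

  \<comment> \<open>Trigger times under the Zeno assumption\<close>
  have "\<forall>t\<in>J. {0..t} \<subseteq> J" "\<forall>t\<in>J. continuous_on {0..t} y" using J y_cont by auto
  note step = trigger_time_step[OF this design(5) c1_less c_dec, folded tau]
  have mono: "strict_mono \<tau>" using step(1) by (simp add: strict_mono_Suc_iff)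
  have \<tau>0: "\<tau> 0 = 0" by (simp add: tau)
  have \<tau>_pos: "0 < \<tau> (Suc i)" for i using strict_monoD[OF mono, of 0 "Suc i"] \<tau>0 by simp

  assume "is_Zeno (time_dom T) \<tau>"
  then obtain a b where inf: "infinite {i. 1 \<le> i \<and> \<tau> i \<in> J \<and> \<tau> i \<in> {a..b}}"
    by (auto simp: is_Zeno_def J_def)
  \<comment> \<open>Infinitely many indices include arbitrarily large ones; since
    \<open>\<tau>\<close> increases and \<open>J\<close> contains all earlier nonnegative times,
    every trigger lies in \<open>J\<close> and is bounded by \<open>b\<close>.\<close>
  have \<tau>J: "\<tau> i \<in> J" and \<tau>b: "\<tau> i \<le> b" for i
  proof -
    obtain k where k: "i \<le> k" "\<tau> k \<in> J" "\<tau> k \<le> b"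
      using inf unfolding infinite_nat_iff_unbounded_le by auto
    have "\<tau> i \<le> \<tau> k" using k(1) mono by (simp add: strict_mono_less_eq)
    moreover have "0 \<le> \<tau> i" using \<tau>0 mono by (metis strict_mono_less_eq le0)
    ultimately show "\<tau> i \<in> J" "\<tau> i \<le> b" using k J[OF k(2)] by auto
  qed

  \<comment> \<open>The estimation error\<close>
  define N where "N i = {w. \<forall>r\<in>{0..\<tau> i}. transpose (\<phi> (x r)) *v w = 0}" for i
  have "subspace (N i)" for i
    by (auto simp: N_def subspace_def matrix_vector_right_distrib matrix_vector_mult_scaleR)
  moreover have "N (Suc i) \<subseteq> N i" for i using step(1)[of i] by (force simp: N_def)
  ultimately obtain k where k: "\<And>i. k \<le> i \<Longrightarrow> N (Suc i) = N i"
    using decreasing_subspaces_stationary by blast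
  \<comment> \<open>Both \<open>\<theta>\<close> and the new estimate solve the same linear system,
    so they differ by a null vector of \<open>data_G\<close>. The initial estimate at index 0 solves
    no such system, hence \<open>Suc i\<close>.\<close>
  have error: "\<theta>h (\<tau> (Suc i)) - \<theta> \<in> N (Suc i)" for i
  proof -
    let ?T = "\<tau> (Suc i)"
    have "data_Z f \<phi> g x u ?T = data_G \<phi> x ?T *v \<theta>h ?T"
      using ls \<tau>J[of "Suc i"] unfolding is_batch_ls_update_def is_arg_min_def by fastforce
    moreover have "data_Z f \<phi> g x u ?T = data_G \<phi> x ?T *v \<theta>"
      using \<tau>J[of "Suc i"] \<tau>_pos[of i]
      by (intro data_Z_eq_data_G_mult[OF traj J _ \<phi>x]) auto
    ultimately have "data_G \<phi> x ?T *v (\<theta>h ?T - \<theta>) = 0"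
      by (simp add: matrix_vector_mult_diff_distrib)
    then show ?thesis using null_space_data_G[OF \<phi>x[OF \<tau>J] \<tau>_pos] by (simp add: N_def)
  qed

  \<comment> \<open>A uniform lower bound on the gaps\<close>
  define \<rho> where "\<rho> = min \<Delta>\<tau>max (\<sigma> * (1 - \<gamma>1))"
  have \<rho>: "0 < \<rho>" using design ratio by (simp add: \<rho>_def)
  \<comment> \<open>\<open>Suc k \<le> i\<close> ensures both \<open>N (Suc i) = N i\<close> and
    that the estimate at \<open>\<tau> i\<close> comes from an actual update.\<close>
  have "\<tau> i + \<rho> \<le> \<tau> (Suc i)" if i: "Suc k \<le> i" for i
  proof (cases "\<tau> (Suc i) = \<tau> i + \<Delta>\<tau>max")
    case True then show ?thesis by (simp add: \<rho>_def)
  next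
    case False
    obtain j where j: "i = Suc j" using i by (cases i) auto
    let ?e = "\<tau> (Suc i)"
    have e: "y ?e = c (Suc i)" using step(2)[of i] False by simp
    have "{\<tau> i..?e} \<subseteq> {0..?e}" using \<tau>_pos[of j] j by auto
    then have yc: "continuous_on {\<tau> i..?e} y" by (rule continuous_on_subset[OF y_cont[OF \<tau>J]])
    have "c i \<le> y (\<tau> i)" using step(3)[OF \<tau>J, of "\<tau> i" j] step(1)[of j] j by simp
    moreover have "y ?e \<le> c i" using e c_dec[of j] j by simp
    \<comment> \<open>From the last visit to \<open>c i\<close> on, the signal stays between
      \<open>c (Suc i)\<close> and \<open>c i\<close>, hence in the range where the ratio bound
      holds.\<close>
    ultimately obtain s where s: "s \<in> {\<tau> i..?e}" "y s = c i" and y_le: "\<And>r. r \<in> {s..?e} \<Longrightarrow> y r \<le> c i"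
      using last_crossing[OF yc, of "c i"] step(1)[of i] by (metis less_imp_le)
    have s0: "0 \<le> s" using s \<tau>_pos[of j] j by simp
    have sJ: "r \<in> J" if "r \<in> {s..?e}" for r using J[OF \<tau>J, of "Suc i"] s0 that by auto
    have true_constraint: "- \<alpha>4 (y r) \<le> Dh (x r) \<bullet> sys_rhs f \<phi> g \<theta> (x r) (u r)"
      if r: "r \<in> {s..?e}" for r
    proof -
      \<comment> \<open>At the right end point the new estimate is already in force; before it the
        one from \<open>\<tau> i\<close> is, whose error lies in
        \<open>N i = N (Suc i)\<close>.\<close>
      have "\<theta>h r - \<theta> \<in> N (Suc i)"
      proof (cases "r = ?e")
        case True then show ?thesis using error by simp
      next
        case False
        then have "\<theta>h r = \<theta>h (\<tau> i)"
          using ls r s sJ[OF r] unfolding is_batch_ls_update_def by (auto simp: less_le)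
        then show ?thesis using error[of j] k[of i] i j by simp
      qed
      \<comment> \<open>The error is invisible up to \<open>\<tau> (Suc i)\<close>, so the
        constraint imposed with the estimate holds for the true dynamics.\<close>
      then have "transpose (\<phi> (x r)) *v \<theta>h r = transpose (\<phi> (x r)) *v \<theta>"
        using r s0 by (simp add: N_def matrix_vector_mult_diff_distrib)
      moreover have "- \<alpha>4 (h (x r)) \<le> Dh (x r) \<bullet> sys_rhs f \<phi> g (\<theta>h r) (x r) (u r)"
        using qp[OF sJ[OF r]] unfolding is_qp_control_def is_arg_min_def qp_feasible_def by force
      ultimately show ?thesis by (simp add: sys_rhs_def y_def)
    qed
    have y_ge: "c (Suc i) \<le> y r" if "r \<in> {s..?e}" for r
      using step(3)[OF \<tau>J, of r] that s(1) by simp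
    have "- (c i / \<sigma>) \<le> Dh (x r) \<bullet> sys_rhs f \<phi> g \<theta> (x r) (u r)" if r: "r \<in> {s..?e}" for r
    proof -
      have pos: "0 < y r" using y_ge[OF r] c_pos[of i] by simp
      moreover have "y r \<le> \<chi>bar" using y_le[OF r] c_le[of j] j by simp
      ultimately have ge: "\<sigma> \<le> y r / \<alpha>4 (y r)" using ratio by simp
      \<comment> \<open>The sign follows from the ratio bound: the quotient is positive, and
        division by zero would give 0.\<close>
      then have "0 < \<alpha>4 (y r)" using pos ratio(3) by (metis less_le_trans zero_less_divide_iff less_asym)
      with ge ratio(3) have "\<alpha>4 (y r) \<le> y r / \<sigma>" by (simp add: field_simps)
      also have "\<dots> \<le> c i / \<sigma>" using y_le[OF r] ratio(3) by (simp add: divide_right_mono)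
      finally show ?thesis using true_constraint[OF r] by linarith
    qed
    then have "h (x s) - c i / \<sigma> * (?e - s) \<le> h (x ?e)"
      using s trajectory_has_integral[OF traj J s0 _ sJ] xX[OF sJ]
      by (intro decrease_along_integral_curve[OF _ _ _ h]) auto
    \<comment> \<open>The drop \<open>c i - \<gamma>1 * c i\<close> and the speed bound
      \<open>c i / \<sigma>\<close> are both proportional to \<open>c i\<close>, which therefore
      cancels.\<close>
    then have "c i * (\<sigma> * (1 - \<gamma>1)) \<le> c i * (?e - s)"
      using s(2) e ratio(3) j by (simp add: y_def c_Suc field_simps)
    then have "\<sigma> * (1 - \<gamma>1) \<le> ?e - s" using c_pos[of j] j by simp
    moreover have "\<rho> \<le> \<sigma> * (1 - \<gamma>1)" by (simp add: \<rho>_def)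
    moreover have "\<tau> i \<le> s" using s(1) by simp
    ultimately show ?thesis by linarith
  qed
  then obtain i where "b < \<tau> i" using unbounded_if_gap[OF \<rho>] by blast
  with \<tau>b[of i] show False by simp
qed

end
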